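(* Let $P(\lambda)=\sum_{i=0}^dP_i\lambda^i\in\mathbb F[\lambda]^{n\times n}$ be a singular matrix polynomial with $d=k\ell$, for some $k$. Let $$\mathcal L(\lambda)=\left[\begin{array}{c|c}M(\lambda)&L_\eta(\lambda^\ell)^T\otimes I_n\\\hline L_\epsilon(\lambda^\ell)\otimes I_n&0\end{array}\right]$$ be an $(\epsilon,n,\eta,n)$-block Kronecker degree-$\ell$ matrix polynomial with $k=\epsilon+\eta+1$ such that $P(\lambda)=(\Lambda_\eta(\lambda^\ell)^T\otimes I_n)M(\lambda)(\Lambda_\epsilon(\lambda^\ell)\otimes I_n)$. Then: (a) If $0\le\epsilon_1\le\epsilon_2\le\cdots\le\epsilon_p$ are the right minimal indices of $P(\lambda)$, then $\epsilon_1+\epsilon\ell\le\epsilon_2+\epsilon\ell\le\cdots\le\epsilon_p+\epsilon\ell$ are the right minimal indices of $\mathcal L(\lambda)$. (b) If $0\le\eta_1\le\eta_2\le\cdots\le\eta_q$ are the left minimal indices of $P(\lambda)$, then $\eta_1+\eta\ell\le\eta_2+\eta\ell\le\cdots\le\eta_q+\eta\ell$ are the left minimal indices of $\mathcal L(\lambda)$.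
   Context: $\mathbb F$ is an arbitrary field. A square matrix polynomial is singular if its determinant is the zero polynomial. A matrix polynomial has grade $g$ if it can be written $\sum_{i=0}^gP_i\lambda^i$ (coefficients possibly zero). $L_k(\lambda)\in\mathbb F[\lambda]^{k\times(k+1)}$ is the bidiagonal pencil with $(i,i)$ entries $-1$, $(i,i+1)$ entries $\lambda$ and other entries $0$. $\Lambda_k(\lambda)^T:=\begin{bmatrix}\lambda^k&\cdots&\lambda&1\end{bmatrix}\in\mathbb F[\lambda]^{1\times(k+1)}$. $L_k(\lambda^\ell),\Lambda_k(\lambda^\ell)$ denote these evaluated at $\lambda^\ell$. $\otimes$ is the Kronecker product. An $(\epsilon,n,\eta,m)$-block Kronecker degree-$\ell$ matrix polynomial ($\ell\ge1$, $\epsilon,\eta\ge0$ integers) is $\left[\begin{array}{c|c}M(\lambda)&L_\eta(\lambda^\ell)^T\otimes I_m\\\hline L_\epsilon(\lambda^\ell)\otimes I_n&0\end{array}\right]$ with $M(\lambda)$ an arbitrary $(\eta+1)m\times(\epsilon+1)n$ matrix polynomial of grade $\ell$; if $\epsilon=0$ (resp. $\eta=0$) the second block row (resp. column) is absent. A minimal basis of a subspace of $\mathbb F(\lambda)^q$ is a basis of vector polynomials with least sum of degrees among all bases of vector polynomials; the ordered list of the degrees of its vectors is independent of the choice, and these degrees are the minimal indices of the subspace. The right (left) minimal indices of a matrix polynomial $P(\lambda)$ are those of $\{x(\lambda):P(\lambda)x(\lambda)=0\}$ (of $\{y(\lambda)^T:y(\lambda)^TP(\lambda)=0\}$), as subspaces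 over $\mathbb F(\lambda)$. *)

theory Defs
  imports
    "Jordan_Normal_Form.Matrix_Kernel"
    "HOL-Computational_Algebra.Polynomial_Factorial"
begin

text \<open>
  Matrix polynomials over a field are matrices with polynomial entries, of type
  \<^typ>\<open>'a::field poly mat\<close>.  The field of rational functions is
  \<^typ>\<open>'a::field poly fract\<close>, with embedding \<^const>\<open>to_fract\<close>.
\<close>

subsection \<open>Matrix polynomials\<close>

definition singular_mat_poly :: "'a::field poly mat \<Rightarrow> bool" where
  "singular_mat_poly P \<longleftrightarrow> square_mat P \<and> det P = 0"

definition has_grade :: "nat \<Rightarrow> 'a::field poly mat \<Rightarrow> bool" where
  "has_grade g P \<longleftrightarrow>
     (\<exists>C :: nat \<Rightarrow> 'a mat.
        (\<forall>i\<le>g. C i \<in> carrier_mat (dim_row P) (dim_col P)) \<and>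
        P = mat (dim_row P) (dim_col P) (\<lambda>rc. \<Sum>i\<le>g. monom (C i $$ rc) i))"

definition eval_at_power :: "nat \<Rightarrow> 'a::field poly mat \<Rightarrow> 'a poly mat" where
  "eval_at_power l A = map_mat (\<lambda>p. p \<circ>\<^sub>p monom 1 l) A"

definition kronecker_prod :: "'a::semiring_0 mat \<Rightarrow> 'a mat \<Rightarrow> 'a mat"
    (infixl \<open>\<otimes>\<^sub>K\<close> 75) where
  "A \<otimes>\<^sub>K B = mat (dim_row A * dim_row B) (dim_col A * dim_col B)
     (\<lambda>(i, j). A $$ (i div dim_row B, j div dim_col B)
             * B $$ (i mod dim_row B, j mod dim_col B))"

subsection \<open>Block Kronecker matrix polynomials\<close>

definition L_pencil :: "nat \<Rightarrow> 'a::field poly mat" where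
  "L_pencil k = mat k (k + 1)
     (\<lambda>(i, j). if j = i then - 1 else if j = i + 1 then monom 1 1 else 0)"

definition Lambda_col :: "nat \<Rightarrow> 'a::field poly mat" where
  "Lambda_col k = mat (k + 1) 1 (\<lambda>(i, j). monom 1 (k - i))"

text \<open>
  For \<open>\<epsilon> = 0\<close> (\<open>\<eta> = 0\<close>) the second block row (column) has
  zero rows (columns), i.e. it is absent.
\<close>

definition block_kronecker ::
    "nat \<Rightarrow> nat \<Rightarrow> nat \<Rightarrow> nat \<Rightarrow> nat \<Rightarrow> 'a::field poly mat \<Rightarrow> 'a poly mat" where
  "block_kronecker \<epsilon> n \<eta> m l M =
     four_block_mat
       M                                            (transpose_mat (eval_at_power l (L_pencil \<eta>)) \<otimes>\<^sub>K 1\<^sub>m m)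
       (eval_at_power l (L_pencil \<epsilon>) \<otimes>\<^sub>K 1\<^sub>m n)  (0\<^sub>m (\<epsilon> * n) (\<eta> * m))"

definition is_block_kronecker ::
    "nat \<Rightarrow> nat \<Rightarrow> nat \<Rightarrow> nat \<Rightarrow> nat \<Rightarrow> 'a::field poly mat \<Rightarrow> 'a poly mat \<Rightarrow> bool" where
  "is_block_kronecker \<epsilon> n \<eta> m l M \<L> \<longleftrightarrow>
     l \<ge> 1 \<and> M \<in> carrier_mat ((\<eta> + 1) * m) ((\<epsilon> + 1) * n) \<and> has_grade l M \<and>
     \<L> = block_kronecker \<epsilon> n \<eta> m l M"

subsection \<open>Minimal bases and minimal indices\<close>

text \<open>
  The degree of a vector polynomial is the maximal degree of its entries.  Inserting
  \<open>0\<close> only matters for the vector of dimension zero.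
\<close>

definition vec_degree :: "'a::field poly vec \<Rightarrow> nat" where
  "vec_degree v = Max (insert 0 (degree ` set\<^sub>v v))"

text \<open>
  A basis of vector polynomials of a subspace \<open>V\<close> of the space of rational vectors
  of length \<open>q\<close>, listed without repetition.
\<close>

definition polynomial_basis ::
    "nat \<Rightarrow> 'a::field poly fract vec set \<Rightarrow> 'a poly vec list \<Rightarrow> bool" where
  "polynomial_basis q V B \<longleftrightarrow>
     set B \<subseteq> carrier_vec q \<and> distinct B \<and>
     vectorspace.basis class_ring
       (module_vec TYPE('a poly fract) q \<lparr>carrier := V\<rparr>)
       (map_vec to_fract ` set B)"

definition minimal_basis ::
    "nat \<Rightarrow> 'a::field poly fract vec set \<Rightarrow> 'a poly vec list \<Rightarrow> bool" where
  "minimal_basis q V B \<longleftrightarrow>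
     polynomial_basis q V B \<and>
     (\<forall>B'. polynomial_basis q V B' \<longrightarrow>
        sum_list (map vec_degree B) \<le> sum_list (map vec_degree B'))"

text \<open>
  \<open>ds\<close> is the list of minimal indices of \<open>V\<close>, in non-decreasing order.  The list
  does not depend on the minimal basis, so at most one \<open>ds\<close> satisfies this.
\<close>

definition minimal_indices ::
    "nat \<Rightarrow> 'a::field poly fract vec set \<Rightarrow> nat list \<Rightarrow> bool" where
  "minimal_indices q V ds \<longleftrightarrow>
     (\<exists>B. minimal_basis q V B \<and> ds = sort (map vec_degree B))"

definition right_nullspace :: "'a::field poly mat \<Rightarrow> 'a poly fract vec set" where
  "right_nullspace P = mat_kernel (map_mat to_fract P)"

definition left_nullspace :: "'a::field poly mat \<Rightarrow> 'a poly fract vec set" where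
  "left_nullspace P =
     {y \<in> carrier_vec (dim_row P). mat_of_row y * map_mat to_fract P = 0\<^sub>m 1 (dim_col P)}"

definition right_minimal_indices :: "'a::field poly mat \<Rightarrow> nat list \<Rightarrow> bool" where
  "right_minimal_indices P ds \<longleftrightarrow> minimal_indices (dim_col P) (right_nullspace P) ds"

definition left_minimal_indices :: "'a::field poly mat \<Rightarrow> nat list \<Rightarrow> bool" where
  "left_minimal_indices P ds \<longleftrightarrow> minimal_indices (dim_row P) (left_nullspace P) ds"

end

theory Submission
  imports Defs "Subresultants.More_Homomorphisms"
begin

text \<open>
  The idea is to exhibit one polynomial matrix \<open>Z\<close> such that \<open>v \<mapsto> Z v\<close> is an isomorphism from the
  right nullspace of \<open>P\<close> onto that of \<open>\<L>\<close> which matches the \<^emph>\<open>polynomial\<close> vectors of the two spaces and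
  raises the degree of every nonzero polynomial vector by exactly \<open>\<epsilon>\<ell>\<close>.  Such a map carries polynomial
  bases to polynomial bases in both directions.  All bases have the same length \<open>p\<close>, so it adds the same
  constant \<open>p\<epsilon>\<ell>\<close> to every sum of degrees; hence it carries minimal bases to minimal bases, and
  each minimal index grows by \<open>\<epsilon>\<ell>\<close> (\<open>minimal_indices_shift\<close>).

  Write \<open>\<mu> = \<lambda>\<^sup>\<ell>\<close>.  A vector \<open>(x, y)\<close> is in the nullspace of \<open>\<L>\<close> iff
  \<open>(L\<^sub>\<epsilon>(\<mu>) \<otimes> I) x = 0\<close> and \<open>M x + (L\<^sub>\<eta>(\<mu>)\<^sup>T \<otimes> I) y = 0\<close>.  The first equation says
  \<open>x = \<Lambda>\<^sub>\<epsilon>(\<mu>) \<otimes> v\<close>, where \<open>v\<close> is the last block of \<open>x\<close>.  The second is a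
  bidiagonal system for \<open>y\<close>: substitution from the top determines \<open>y\<close> as a polynomial combination of
  \<open>M x\<close>, and the one remaining equation is \<open>P v = 0\<close>.  So \<open>Z\<close> stacks \<open>\<Lambda>\<^sub>\<epsilon>(\<mu>) \<otimes> I\<close> on the
  solution operator, and selecting the last block of \<open>x\<close> inverts it.  All of this is encoded by a few
  polynomial matrix identities (locale \<open>dual_block_pencil\<close>), which hold over the polynomials and
  therefore over the rational functions as well.

  For the degrees, \<open>x\<close> has degree exactly \<open>deg v + \<epsilon>\<ell>\<close>.  The entries of \<open>y\<close> do not exceed
  this, but the formula that produces \<open>y\<close> from the top does not show it, because its terms
  cancel.  Reading the same bidiagonal system from the bottom gives \<open>\<mu> y\<^sub>i = y\<^sub>i\<^sub>+\<^sub>1 - (M x)\<^sub>i\<^sub>+\<^sub>1\<close> with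
  \<open>deg (M x) \<le> \<ell> + deg v + \<epsilon>\<ell>\<close>, since \<open>M\<close> has grade \<open>\<ell>\<close>; cancelling \<open>\<mu>\<close> gives the bound.

  Left nullspaces are right nullspaces of transposes, and transposing \<open>\<L>\<close> swaps \<open>\<epsilon>\<close> with
  \<open>\<eta>\<close>, so the left half is the right half applied to \<open>\<L>\<^sup>T\<close>.
\<close>

section \<open>Transport of minimal indices along polynomial isomorphisms\<close>

lemma kernel_isomorphism_basis:
  fixes A B Z E :: "'k::field mat"
  assumes A: "A \<in> carrier_mat m q" and B: "B \<in> carrier_mat s r"
    and Z: "Z \<in> carrier_mat r q"
    and Zker: "\<And>v. v \<in> mat_kernel A \<Longrightarrow> Z *\<^sub>v v \<in> mat_kernel B"
    and Eker: "\<And>w. w \<in> mat_kernel B \<Longrightarrow> E *\<^sub>v w \<in> mat_kernel A"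
    and EZ: "\<And>v. v \<in> mat_kernel A \<Longrightarrow> E *\<^sub>v (Z *\<^sub>v v) = v"
    and ZE: "\<And>w. w \<in> mat_kernel B \<Longrightarrow> Z *\<^sub>v (E *\<^sub>v w) = w"
    and basis: "kernel.basis q A X"
  shows "kernel.basis r B ((\<lambda>v. Z *\<^sub>v v) ` X)"
proof -
  interpret kA: kernel m q A by (unfold_locales, rule A)
  interpret kB: kernel s r B by (unfold_locales, rule B)
  have sub: "mat_kernel A \<subseteq> carrier_vec q" by (rule mat_kernel_carrier[OF A])
  have hom: "mod_hom class_ring kA.VK kB.VK (\<lambda>v. Z *\<^sub>v v)"
  proof (intro mod_hom.intro mod_hom_axioms.intro)
    show "Module.module class_ring kA.VK" by (rule kA.Ker.module_axioms)
    show "Module.module class_ring kB.VK" by (rule kB.Ker.module_axioms)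
    show "(\<lambda>v. Z *\<^sub>v v) \<in> LinearCombinations.module_hom class_ring kA.VK kB.VK"
      using Zker sub Z
      by (auto simp: LinearCombinations.module_hom_def module_vec_simps mult_add_distrib_mat_vec[OF Z]
          mult_mat_vec[OF Z] subset_iff)
  qed
  interpret lin: linear_map class_ring kA.VK kB.VK "\<lambda>v. Z *\<^sub>v v"
    by (intro linear_map.intro kA.Ker.vectorspace_axioms kB.Ker.vectorspace_axioms hom)
  obtain X0 where "finite X0" "kA.basis X0" using kernel_basis_exists[OF A] by blast
  then have fin: "kA.Ker.fin_dim"
    unfolding kA.Ker.fin_dim_def kA.Ker.basis_def by auto
  show ?thesis
  proof (rule lin.linear_inj_image_is_basis[OF _ _ basis fin])
    show "inj_on (\<lambda>v. Z *\<^sub>v v) (carrier kA.VK)"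
      by (rule inj_on_inverseI[where g = "\<lambda>w. E *\<^sub>v w"]) (simp add: EZ)
    show "(\<lambda>v. Z *\<^sub>v v) ` carrier kA.VK = carrier kB.VK"
    proof (intro equalityI subsetI)
      fix w assume "w \<in> carrier kB.VK"
      then have w: "w \<in> mat_kernel B" by simp
      show "w \<in> (\<lambda>v. Z *\<^sub>v v) ` carrier kA.VK"
        by (rule image_eqI[of _ _ "E *\<^sub>v w"]) (simp_all add: w ZE Eker)
    qed (auto dest: Zker)
  qed
qed

lemma mult_mat_vec_zero:
  fixes X :: "'k::comm_ring_1 mat"
  assumes "X \<in> carrier_mat i j"
  shows "X *\<^sub>v 0\<^sub>v j = 0\<^sub>v i"
  using assms by (intro eq_vecI) auto

lemma kernel_basis_card:
  fixes A :: "'k::field mat"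
  assumes A: "A \<in> carrier_mat m q" and "finite X" and "kernel.basis q A X"
  shows "card X = kernel.dim q A"
proof -
  interpret kA: kernel m q A by (unfold_locales, rule A)
  show ?thesis using kA.Ker.dim_basis[OF assms(2,3)] by simp
qed

lemma kernel_basis_zero_notin:
  fixes A :: "'k::field mat"
  assumes A: "A \<in> carrier_mat m q" and basis: "kernel.basis q A X"
  shows "0\<^sub>v q \<notin> X"
proof -
  interpret kA: kernel m q A by (unfold_locales, rule A)
  have "(UNIV :: 'k set) \<noteq> {0}" by (metis UNIV_I singletonD zero_neq_one)
  then show ?thesis using kA.Ker.zero_nin_lin_indpt[of X] basis
    unfolding kA.Ker.basis_def by auto
qed

lemma sort_map_add_right:
  fixes f :: "'b \<Rightarrow> nat"
  shows "sort (map (\<lambda>x. f x + c) xs) = map (\<lambda>e. e + c) (sort (map f xs))"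
  by (rule properties_for_sort) (simp_all add: sorted_map sorted_wrt_map image_mset.compositionality o_def
    sorted_wrt_mono_rel[of _ "(\<le>)"])

text \<open>
  The hypotheses make multiplication by \<open>Z\<close> and by \<open>E\<close> mutually inverse between the two nullspaces: on the
  kernel of \<open>B\<close> the correction \<open>Y * B\<close> vanishes, so \<open>Z * E\<close> acts there as the identity, and left
  invertibility of \<open>S\<close> sends the kernel of \<open>B\<close> back into that of \<open>A\<close>.  They are identities between polynomial
  matrices rather than statements about kernels so that they survive the embedding into rational
  functions, and polynomiality of both \<open>Z\<close> and \<open>E\<close> is what makes polynomial bases correspond.
\<close>

lemma minimal_indices_shift:
  fixes A B Z E :: "'a::field poly mat"
  assumes A: "A \<in> carrier_mat m q" and B: "B \<in> carrier_mat s r"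
    and Z: "Z \<in> carrier_mat r q" and E: "E \<in> carrier_mat q r"
    and S: "S \<in> carrier_mat s m" and S': "S' \<in> carrier_mat m s" and Y: "Y \<in> carrier_mat r s"
    and BZ: "B * Z = S * A" and SS: "S' * S = 1\<^sub>m m"
    and EZ: "E * Z = 1\<^sub>m q" and ZE: "Z * E = 1\<^sub>m r + Y * B"
    and deg: "\<And>v. v \<in> carrier_vec q \<Longrightarrow> v \<noteq> 0\<^sub>v q \<Longrightarrow> A *\<^sub>v v = 0\<^sub>v m \<Longrightarrow>
                vec_degree (Z *\<^sub>v v) = vec_degree v + c"
    and ind: "right_minimal_indices A ds"
  shows "right_minimal_indices B (map (\<lambda>e. e + c) ds)"
proof -
  define h :: "'a poly mat \<Rightarrow> 'a poly fract mat" where "h = map_mat to_fract"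
  define hv :: "'a poly vec \<Rightarrow> 'a poly fract vec" where "hv = map_vec to_fract"
  have carr: "h X \<in> carrier_mat i j \<longleftrightarrow> X \<in> carrier_mat i j" for X i j
    by (simp add: h_def)
  have carrv [simp]: "hv x \<in> carrier_vec i \<longleftrightarrow> x \<in> carrier_vec i" for x i
    unfolding hv_def by (rule map_carrier_vec)
  have h_mult: "h (X * X') = h X * h X'"
    if "X \<in> carrier_mat i j" "X' \<in> carrier_mat j k" for X X' i j k
    unfolding h_def by (rule to_fract_hom.mat_hom_mult[OF that])
  have hv_mult: "hv (X *\<^sub>v x) = h X *\<^sub>v hv x"
    if "X \<in> carrier_mat i j" "x \<in> carrier_vec j" for X x i j
    unfolding h_def hv_def by (rule to_fract_hom.mult_mat_vec_hom[OF that])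
  have hv_inj: "hv x = hv y \<longleftrightarrow> x = y" for x y
    using to_fract_hom.vec_hom_inj unfolding hv_def by blast
  have hv_zero: "hv x = 0\<^sub>v i \<longleftrightarrow> x = 0\<^sub>v i" for x i
    unfolding hv_def by simp
  have h_one: "h (1\<^sub>m i) = 1\<^sub>m i" for i unfolding h_def by (rule to_fract_hom.mat_hom_one)
  have h_add: "h (X + X') = h X + h X'"
    if "X \<in> carrier_mat i j" "X' \<in> carrier_mat i j" for X X' i j
    using that unfolding h_def by (intro eq_matI) auto
  have hA: "h A \<in> carrier_mat m q" and hB: "h B \<in> carrier_mat s r"
    and hZ: "h Z \<in> carrier_mat r q" and hE: "h E \<in> carrier_mat q r"
    and hS: "h S \<in> carrier_mat s m" and hS': "h S' \<in> carrier_mat m s"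
    and hY: "h Y \<in> carrier_mat r s"
    using A B Z E S S' Y by (simp_all add: carr)
  have hBZ: "h B * h Z = h S * h A"
    using arg_cong[OF BZ, of h] h_mult[OF B Z] h_mult[OF S A] by simp
  have hSS: "h S' * h S = 1\<^sub>m m"
    using arg_cong[OF SS, of h] h_mult[OF S' S] h_one by simp
  have hEZ: "h E * h Z = 1\<^sub>m q"
    using arg_cong[OF EZ, of h] h_mult[OF E Z] h_one by simp
  have hZE: "h Z * h E = 1\<^sub>m r + h Y * h B"
    using arg_cong[OF ZE, of h] h_mult[OF Z E] h_mult[OF Y B] h_one
      h_add[of "1\<^sub>m r" r r "Y * B"] Y B by simp
  have kerA: "v \<in> mat_kernel (h A) \<longleftrightarrow> v \<in> carrier_vec q \<and> h A *\<^sub>v v = 0\<^sub>v m" for v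
    using mat_kernel[OF hA] by auto
  have kerB: "v \<in> mat_kernel (h B) \<longleftrightarrow> v \<in> carrier_vec r \<and> h B *\<^sub>v v = 0\<^sub>v s" for v
    using mat_kernel[OF hB] by auto
  have retract: "h E *\<^sub>v (h Z *\<^sub>v v) = v" if "v \<in> mat_kernel (h A)" for v
    using that hEZ by (simp add: kerA assoc_mult_mat_vec[OF hE hZ, symmetric])
  have section_ker: "h Z *\<^sub>v (h E *\<^sub>v w) = w" if w: "w \<in> mat_kernel (h B)" for w
  proof -
    have "h Z *\<^sub>v (h E *\<^sub>v w) = (1\<^sub>m r + h Y * h B) *\<^sub>v w"
      using w hZE by (simp add: kerB assoc_mult_mat_vec[OF hZ hE, symmetric])
    also have "\<dots> = w + h Y *\<^sub>v (h B *\<^sub>v w)"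
      using w hY hB by (simp add: kerB add_mult_distrib_mat_vec[of _ r r]
          assoc_mult_mat_vec[OF hY hB])
    finally show ?thesis using w by (simp add: kerB mult_mat_vec_zero[OF hY])
  qed
  have Zker: "h Z *\<^sub>v v \<in> mat_kernel (h B)" if v: "v \<in> mat_kernel (h A)" for v
  proof -
    have "h B *\<^sub>v (h Z *\<^sub>v v) = h S *\<^sub>v (h A *\<^sub>v v)"
      using v by (metis kerA hBZ assoc_mult_mat_vec[OF hB hZ] assoc_mult_mat_vec[OF hS hA])
    then show ?thesis using v hZ by (simp add: kerA kerB mult_mat_vec_zero[OF hS])
  qed
  have Eker: "h E *\<^sub>v w \<in> mat_kernel (h A)" if w: "w \<in> mat_kernel (h B)" for w
  proof -
    let ?v = "h E *\<^sub>v w"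
    have v: "?v \<in> carrier_vec q" using w hE by (simp add: kerB)
    have "h S *\<^sub>v (h A *\<^sub>v ?v) = h B *\<^sub>v (h Z *\<^sub>v ?v)"
      using v by (metis hBZ assoc_mult_mat_vec[OF hB hZ] assoc_mult_mat_vec[OF hS hA])
    also have "\<dots> = 0\<^sub>v s" using section_ker[OF w] w by (simp add: kerB)
    finally have "h S' *\<^sub>v (h S *\<^sub>v (h A *\<^sub>v ?v)) = 0\<^sub>v m" by (simp add: mult_mat_vec_zero[OF hS'])
    moreover have "h A *\<^sub>v ?v \<in> carrier_vec m" using hA v by simp
    ultimately have "h A *\<^sub>v ?v = 0\<^sub>v m"
      using hSS by (simp add: assoc_mult_mat_vec[OF hS' hS, symmetric])
    then show ?thesis using v by (simp add: kerA)
  qed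
  have pbA: "polynomial_basis q (mat_kernel (h A)) L \<longleftrightarrow>
      set L \<subseteq> carrier_vec q \<and> distinct L \<and> kernel.basis q (h A) (hv ` set L)" for L
    unfolding polynomial_basis_def hv_def ..
  have pbB: "polynomial_basis r (mat_kernel (h B)) L \<longleftrightarrow>
      set L \<subseteq> carrier_vec r \<and> distinct L \<and> kernel.basis r (h B) (hv ` set L)" for L
    unfolding polynomial_basis_def hv_def ..
  have basis_sub: "hv ` set L \<subseteq> mat_kernel (h A)"
    if "polynomial_basis q (mat_kernel (h A)) L" for L
  proof -
    interpret k: kernel m q "h A" by (unfold_locales, rule hA)
    show ?thesis using that unfolding pbA k.Ker.basis_def by simp
  qed
  have basis_subB: "hv ` set L \<subseteq> mat_kernel (h B)"
    if "polynomial_basis r (mat_kernel (h B)) L" for L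
  proof -
    interpret k: kernel s r "h B" by (unfold_locales, rule hB)
    show ?thesis using that unfolding pbB k.Ker.basis_def by simp
  qed
  have len: "length L = kernel.dim q (h A)" if L: "polynomial_basis q (mat_kernel (h A)) L" for L
  proof -
    have "length L = card (hv ` set L)"
      using L by (simp add: pbA distinct_card card_image inj_on_def hv_inj)
    also have "\<dots> = kernel.dim q (h A)"
      using L by (intro kernel_basis_card[OF hA]) (auto simp: pbA)
    finally show ?thesis .
  qed
  have EZp: "E *\<^sub>v (Z *\<^sub>v v) = v" if "v \<in> carrier_vec q" for v
    using that EZ by (simp add: assoc_mult_mat_vec[OF E Z, symmetric])
  have ZEp: "Z *\<^sub>v (E *\<^sub>v w) = w" if L: "polynomial_basis r (mat_kernel (h B)) L" "w \<in> set L" for w L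
  proof -
    have w: "w \<in> carrier_vec r" using L by (auto simp: pbB)
    have "hv (Z *\<^sub>v (E *\<^sub>v w)) = h Z *\<^sub>v (h E *\<^sub>v hv w)"
      using w E by (simp add: hv_mult[OF Z] hv_mult[OF E])
    also have "\<dots> = hv w" using basis_subB[OF L(1)] L(2) by (intro section_ker) auto
    finally show ?thesis by (simp add: hv_inj)
  qed
  have push: "polynomial_basis r (mat_kernel (h B)) (map (\<lambda>v. Z *\<^sub>v v) L)"
    if L: "polynomial_basis q (mat_kernel (h A)) L" for L
  proof -
    have sub: "set L \<subseteq> carrier_vec q" using L by (simp add: pbA)
    have img: "hv ` (\<lambda>v. Z *\<^sub>v v) ` set L = (\<lambda>v. h Z *\<^sub>v v) ` hv ` set L"
      unfolding image_image using sub by (intro image_cong refl hv_mult[OF Z]) auto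
    have "inj_on (\<lambda>v. Z *\<^sub>v v) (set L)"
      by (rule inj_on_inverseI[where g = "\<lambda>w. E *\<^sub>v w"]) (use sub EZp in auto)
    then show ?thesis
      using L Z kernel_isomorphism_basis[OF hA hB hZ Zker Eker retract section_ker]
      by (auto simp: pbB pbA distinct_map img)
  qed
  have pull: "polynomial_basis q (mat_kernel (h A)) (map (\<lambda>v. E *\<^sub>v v) L)"
    if L: "polynomial_basis r (mat_kernel (h B)) L" for L
  proof -
    have sub: "set L \<subseteq> carrier_vec r" using L by (simp add: pbB)
    have img: "hv ` (\<lambda>v. E *\<^sub>v v) ` set L = (\<lambda>v. h E *\<^sub>v v) ` hv ` set L"
      unfolding image_image using sub by (intro image_cong refl hv_mult[OF E]) auto
    have "inj_on (\<lambda>v. E *\<^sub>v v) (set L)"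
      by (rule inj_on_inverseI[where g = "\<lambda>w. Z *\<^sub>v w"]) (use ZEp L in auto)
    then show ?thesis
      using L E kernel_isomorphism_basis[OF hB hA hE Eker Zker section_ker retract]
      by (auto simp: pbB pbA distinct_map img)
  qed
  have degs: "map vec_degree (map (\<lambda>v. Z *\<^sub>v v) L) = map (\<lambda>v. vec_degree v + c) L"
    if L: "polynomial_basis q (mat_kernel (h A)) L" for L
  proof -
    have "vec_degree (Z *\<^sub>v v) = vec_degree v + c" if v: "v \<in> set L" for v
    proof (rule deg)
      show vc: "v \<in> carrier_vec q" using L v by (auto simp: pbA)
      have "hv v \<noteq> 0\<^sub>v q" using kernel_basis_zero_notin[OF hA] L v by (metis pbA imageI)
      then show "v \<noteq> 0\<^sub>v q" by (simp add: hv_zero)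
      have "h A *\<^sub>v hv v = 0\<^sub>v m" using basis_sub[OF L] v by (auto simp: kerA)
      then show "A *\<^sub>v v = 0\<^sub>v m" by (simp add: hv_mult[OF A vc, symmetric] hv_zero)
    qed
    then show ?thesis by simp
  qed
  have sums: "sum_list (map vec_degree (map (\<lambda>v. Z *\<^sub>v v) L)) =
      sum_list (map vec_degree L) + kernel.dim q (h A) * c"
    if L: "polynomial_basis q (mat_kernel (h A)) L" for L
    unfolding degs[OF L] len[OF L, symmetric] by (induction L) auto
  have dimA: "dim_col A = q" and dimB: "dim_col B = r" using A B by auto
  from ind obtain L where L: "minimal_basis q (mat_kernel (h A)) L"
    and ds: "ds = sort (map vec_degree L)"
    unfolding right_minimal_indices_def minimal_indices_def right_nullspace_def dimA h_def by blast
  have pL: "polynomial_basis q (mat_kernel (h A)) L" using L by (simp add: minimal_basis_def)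
  have "minimal_basis r (mat_kernel (h B)) (map (\<lambda>v. Z *\<^sub>v v) L)"
    unfolding minimal_basis_def
  proof (intro conjI allI impI push[OF pL])
    fix L' assume L': "polynomial_basis r (mat_kernel (h B)) L'"
    let ?K = "map (\<lambda>w. E *\<^sub>v w) L'"
    have K: "polynomial_basis q (mat_kernel (h A)) ?K" by (rule pull[OF L'])
    \<comment> \<open>every competitor is the image of a polynomial basis of the kernel of \<open>A\<close>\<close>
    have "L' = map (\<lambda>v. Z *\<^sub>v v) ?K" using ZEp[OF L'] by (simp add: map_idI)
    moreover have "sum_list (map vec_degree L) \<le> sum_list (map vec_degree ?K)"
      using L K unfolding minimal_basis_def by blast
    ultimately show "sum_list (map vec_degree (map (\<lambda>v. Z *\<^sub>v v) L)) \<le> sum_list (map vec_degree L')"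
      using sums[OF pL] sums[OF K] by simp
  qed
  moreover have "map (\<lambda>e. e + c) ds = sort (map vec_degree (map (\<lambda>v. Z *\<^sub>v v) L))"
    unfolding ds degs[OF pL] by (rule sort_map_add_right[symmetric])
  ultimately show ?thesis
    unfolding right_minimal_indices_def minimal_indices_def right_nullspace_def dimB h_def by blast
qed

section \<open>Kronecker products with an identity matrix\<close>

lemma kronecker_index_less:
  fixes i a r n :: nat
  assumes "i < r" "a < n"
  shows "i * n + a < r * n"
proof -
  have "i * n + a < Suc i * n" using assms by simp
  also have "\<dots> \<le> r * n" using assms by (intro mult_right_mono) auto
  finally show ?thesis .
qed

lemma sum_kronecker_index:
  fixes f :: "nat \<Rightarrow> 'b::comm_monoid_add"
  shows "(\<Sum>k<c * n. f k) = (\<Sum>j<c. \<Sum>b<n. f (j * n + b))"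
proof -
  have "(\<Sum>k<c * n. f k) = (\<Sum>j<c. sum f {j * n..<j * n + n})"
    by (rule sum.nat_group[symmetric])
  also have "\<dots> = (\<Sum>j<c. \<Sum>b<n. f (j * n + b))"
  proof (rule sum.cong[OF refl])
    fix j
    show "sum f {j * n..<j * n + n} = (\<Sum>b<n. f (j * n + b))"
      using sum.shift_bounds_nat_ivl[of f 0 "j * n" n] by (simp add: atLeast0LessThan add.commute)
  qed
  finally show ?thesis .
qed

lemma kronecker_carrier:
  "A \<in> carrier_mat r c \<Longrightarrow> B \<in> carrier_mat r' c' \<Longrightarrow> A \<otimes>\<^sub>K B \<in> carrier_mat (r * r') (c * c')"
  by (auto simp: kronecker_prod_def)

lemma transpose_kronecker:
  "transpose_mat (A \<otimes>\<^sub>K B) = transpose_mat A \<otimes>\<^sub>K transpose_mat B"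
proof (rule eq_matI)
  fix i j
  assume ij: "i < dim_row (transpose_mat A \<otimes>\<^sub>K transpose_mat B)" "j < dim_col (transpose_mat A \<otimes>\<^sub>K transpose_mat B)"
  then have "i < dim_col A * dim_col B" "j < dim_row A * dim_row B"
    by (simp_all add: kronecker_prod_def)
  moreover from this have "0 < dim_col B" "0 < dim_row B" by (auto intro: Nat.gr0I)
  ultimately show "transpose_mat (A \<otimes>\<^sub>K B) $$ (i, j) = (transpose_mat A \<otimes>\<^sub>K transpose_mat B) $$ (i, j)"
    by (simp add: kronecker_prod_def less_mult_imp_div_less)
qed (simp_all add: kronecker_prod_def)

lemma kronecker_one_index:
  fixes A :: "'b::comm_ring_1 mat"
  assumes "i < dim_row A" "j < dim_col A" "a < n" "b < n"
  shows "(A \<otimes>\<^sub>K 1\<^sub>m n) $$ (i * n + a, j * n + b) = (if a = b then A $$ (i, j) else 0)"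
  using assms by (simp add: kronecker_prod_def kronecker_index_less)

text \<open>
  Indices below \<open>r * n\<close> are pairs (block, position in block), which turns an equation between block
  matrices into one between their blocks.
\<close>

lemma kronecker_one_eqI:
  fixes X Y :: "'b mat"
  assumes "X \<in> carrier_mat (r * n) (c * n)" "Y \<in> carrier_mat (r * n) (c * n)"
    and eq: "\<And>i j a b. i < r \<Longrightarrow> j < c \<Longrightarrow> a < n \<Longrightarrow> b < n \<Longrightarrow>
      X $$ (i * n + a, j * n + b) = Y $$ (i * n + a, j * n + b)"
  shows "X = Y"
proof (rule eq_matI)
  fix i j assume "i < dim_row Y" "j < dim_col Y"
  then have ij: "i < r * n" "j < c * n" using assms(2) by auto
  then have "0 < n" by (auto intro: Nat.gr0I)
  then show "X $$ (i, j) = Y $$ (i, j)"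
    using eq[of "i div n" "j div n" "i mod n" "j mod n"] ij
    by (simp add: less_mult_imp_div_less)
qed (use assms in auto)

lemma kronecker_one_mult:
  fixes A B :: "'b::comm_ring_1 mat"
  assumes A: "A \<in> carrier_mat r s" and B: "B \<in> carrier_mat s c"
  shows "(A \<otimes>\<^sub>K 1\<^sub>m n) * (B \<otimes>\<^sub>K 1\<^sub>m n) = (A * B) \<otimes>\<^sub>K 1\<^sub>m n"
proof (rule kronecker_one_eqI)
  note KA = kronecker_carrier[OF A one_carrier_mat[of n]]
  note KB = kronecker_carrier[OF B one_carrier_mat[of n]]
  show "(A \<otimes>\<^sub>K 1\<^sub>m n) * (B \<otimes>\<^sub>K 1\<^sub>m n) \<in> carrier_mat (r * n) (c * n)"
    by (rule mult_carrier_mat[OF KA KB])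
  show "(A * B) \<otimes>\<^sub>K 1\<^sub>m n \<in> carrier_mat (r * n) (c * n)"
    by (rule kronecker_carrier[OF mult_carrier_mat[OF A B] one_carrier_mat])
  fix i j a b assume *: "i < r" "j < c" "a < n" "b < n"
  have "((A \<otimes>\<^sub>K 1\<^sub>m n) * (B \<otimes>\<^sub>K 1\<^sub>m n)) $$ (i * n + a, j * n + b) =
    (\<Sum>k<s * n. (A \<otimes>\<^sub>K 1\<^sub>m n) $$ (i * n + a, k) * (B \<otimes>\<^sub>K 1\<^sub>m n) $$ (k, j * n + b))"
    using KA KB * by (simp add: scalar_prod_def kronecker_index_less atLeast0LessThan)
  also have "\<dots> = (\<Sum>k<s. \<Sum>d<n. if d = a then (if a = b then A $$ (i, k) * B $$ (k, j) else 0) else 0)"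
    unfolding sum_kronecker_index
    using A B * by (intro sum.cong refl) (auto simp: kronecker_one_index)
  also have "\<dots> = (if a = b then (A * B) $$ (i, j) else 0)"
    using A B * by (simp add: scalar_prod_def atLeast0LessThan)
  also have "\<dots> = ((A * B) \<otimes>\<^sub>K 1\<^sub>m n) $$ (i * n + a, j * n + b)"
    using A B * by (simp add: kronecker_one_index)
  finally show "((A \<otimes>\<^sub>K 1\<^sub>m n) * (B \<otimes>\<^sub>K 1\<^sub>m n)) $$ (i * n + a, j * n + b) =
    ((A * B) \<otimes>\<^sub>K 1\<^sub>m n) $$ (i * n + a, j * n + b)" .
qed

lemma kronecker_one_add:
  fixes A B :: "'b::comm_ring_1 mat"
  assumes A: "A \<in> carrier_mat r c" and B: "B \<in> carrier_mat r c"
  shows "(A + B) \<otimes>\<^sub>K 1\<^sub>m n = (A \<otimes>\<^sub>K 1\<^sub>m n) + (B \<otimes>\<^sub>K 1\<^sub>m n)"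
proof (rule kronecker_one_eqI)
  note KA = kronecker_carrier[OF A one_carrier_mat[of n]]
  note KB = kronecker_carrier[OF B one_carrier_mat[of n]]
  show "(A + B) \<otimes>\<^sub>K 1\<^sub>m n \<in> carrier_mat (r * n) (c * n)"
    using A B by (intro kronecker_carrier) auto
  show "(A \<otimes>\<^sub>K 1\<^sub>m n) + (B \<otimes>\<^sub>K 1\<^sub>m n) \<in> carrier_mat (r * n) (c * n)"
    using KA KB by simp
  fix i j a b assume *: "i < r" "j < c" "a < n" "b < n"
  then show "((A + B) \<otimes>\<^sub>K 1\<^sub>m n) $$ (i * n + a, j * n + b) =
    ((A \<otimes>\<^sub>K 1\<^sub>m n) + (B \<otimes>\<^sub>K 1\<^sub>m n)) $$ (i * n + a, j * n + b)"
    using A B KA KB by (simp add: kronecker_one_index kronecker_index_less)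
qed

lemma kronecker_one_one: "1\<^sub>m k \<otimes>\<^sub>K 1\<^sub>m n = (1\<^sub>m (k * n) :: 'b::comm_ring_1 mat)"
proof (rule kronecker_one_eqI)
  show "1\<^sub>m k \<otimes>\<^sub>K 1\<^sub>m n \<in> carrier_mat (k * n) (k * n)"
    by (intro kronecker_carrier one_carrier_mat)
  fix i j a b assume *: "i < k" "j < k" "a < n" "b < n"
  have "i * n + a = j * n + b \<longleftrightarrow> i = j \<and> a = b"
  proof
    assume "i * n + a = j * n + b"
    then have "(i * n + a) div n = (j * n + b) div n" "(i * n + a) mod n = (j * n + b) mod n"
      by simp_all
    then show "i = j \<and> a = b" using * by simp
  qed simp
  then show "(1\<^sub>m k \<otimes>\<^sub>K 1\<^sub>m n) $$ (i * n + a, j * n + b) = (1\<^sub>m (k * n) :: 'b mat) $$ (i * n + a, j * n + b)"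
    using * by (simp add: kronecker_one_index kronecker_index_less)
qed simp

lemma kronecker_zero_one: "0\<^sub>m r c \<otimes>\<^sub>K 1\<^sub>m n = (0\<^sub>m (r * n) (c * n) :: 'b::comm_ring_1 mat)"
proof (rule kronecker_one_eqI)
  show "0\<^sub>m r c \<otimes>\<^sub>K 1\<^sub>m n \<in> carrier_mat (r * n) (c * n)"
    by (intro kronecker_carrier one_carrier_mat zero_carrier_mat)
qed (simp_all add: kronecker_one_index kronecker_index_less)

lemma kronecker_one_mult_vec_index:
  fixes A :: "'b::comm_ring_1 mat"
  assumes A: "A \<in> carrier_mat r c" and v: "v \<in> carrier_vec (c * n)" and "i < r" "a < n"
  shows "((A \<otimes>\<^sub>K 1\<^sub>m n) *\<^sub>v v) $ (i * n + a) = (\<Sum>j<c. A $$ (i, j) * v $ (j * n + a))"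
proof -
  note KA = kronecker_carrier[OF A one_carrier_mat[of n]]
  have "((A \<otimes>\<^sub>K 1\<^sub>m n) *\<^sub>v v) $ (i * n + a) = (\<Sum>k<c * n. (A \<otimes>\<^sub>K 1\<^sub>m n) $$ (i * n + a, k) * v $ k)"
    using KA v assms(3,4) by (simp add: scalar_prod_def kronecker_index_less atLeast0LessThan)
  also have "\<dots> = (\<Sum>j<c. \<Sum>b<n. if b = a then A $$ (i, j) * v $ (j * n + a) else 0)"
    unfolding sum_kronecker_index
    using A assms(3,4) by (intro sum.cong refl) (auto simp: kronecker_one_index)
  finally show ?thesis using assms(4) by simp
qed

section \<open>The bidiagonal pencil and its dual basis\<close>

definition L_power :: "nat \<Rightarrow> nat \<Rightarrow> 'a::field poly mat" where
  "L_power l k = eval_at_power l (L_pencil k)"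

definition Lambda_power :: "nat \<Rightarrow> nat \<Rightarrow> 'a::field poly mat" where
  "Lambda_power l k = eval_at_power l (Lambda_col k)"

text \<open>
  Up to sign this solves the first \<open>k\<close> of the \<open>k + 1\<close> equations of \<open>L\<^sub>k(\<mu>)\<^sup>T y = w\<close> by substitution:
  \<open>y\<^sub>i = - (\<mu>\<^sup>i w\<^sub>0 + \<dots> + w\<^sub>i)\<close>.
\<close>

definition back_subst :: "nat \<Rightarrow> nat \<Rightarrow> 'a::field poly mat" where
  "back_subst l k = mat k (k + 1) (\<lambda>(i, j). if j \<le> i then monom 1 (l * (i - j)) else 0)"

definition last_unit_row :: "nat \<Rightarrow> 'a::field poly mat" where
  "last_unit_row k = mat 1 (k + 1) (\<lambda>(i, j). if j = k then 1 else 0)"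

lemma monom_pcompose_monom: "monom (1::'a::field) k \<circ>\<^sub>p monom 1 l = monom 1 (l * k)"
proof (induction k)
  case (Suc k)
  then show ?case by (simp add: monom_Suc mult_monom)
qed (simp flip: one_poly_eq_simps)

lemma L_power_eq: "L_power l k = mat k (k + 1)
    (\<lambda>(i, j). if j = i then - 1 else if j = i + 1 then monom 1 l else 0)"
  unfolding L_power_def eval_at_power_def L_pencil_def
  by (rule eq_matI) (auto simp: monom_pcompose_monom pcompose_uminus)

lemma Lambda_power_eq: "Lambda_power l k = mat (k + 1) 1 (\<lambda>(i, j). monom 1 (l * (k - i)))"
  unfolding Lambda_power_def eval_at_power_def Lambda_col_def
  by (rule eq_matI) (auto simp: monom_pcompose_monom)

lemma inner_carriers [simp]:
  "L_power l k \<in> carrier_mat k (k + 1)"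
  "Lambda_power l k \<in> carrier_mat (k + 1) 1"
  "back_subst l k \<in> carrier_mat k (k + 1)"
  "last_unit_row k \<in> carrier_mat 1 (k + 1)"
  by (simp_all add: L_power_eq Lambda_power_eq back_subst_def last_unit_row_def)

lemma inner_dims [simp]:
  "dim_row (L_power l k) = k" "dim_col (L_power l k) = k + 1"
  "dim_row (Lambda_power l k) = k + 1" "dim_col (Lambda_power l k) = 1"
  "dim_row (back_subst l k) = k" "dim_col (back_subst l k) = k + 1"
  "dim_row (last_unit_row k) = 1" "dim_col (last_unit_row k) = k + 1"
  by (simp_all add: L_power_eq Lambda_power_eq back_subst_def last_unit_row_def)

lemma L_power_row_sum:
  assumes "i < k"
  shows "(\<Sum>j<k + 1. L_power l k $$ (i, j) * f j) = monom 1 l * f (i + 1) - f i"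
proof -
  have "(\<Sum>j<k + 1. L_power l k $$ (i, j) * f j) =
      (\<Sum>j<k + 1. (if j = i then - f j else 0) + (if j = i + 1 then monom 1 l * f j else 0))"
    using assms by (intro sum.cong refl) (auto simp: L_power_eq)
  also have "\<dots> = monom 1 l * f (i + 1) - f i"
    using assms by (simp add: sum.distrib del: sum.lessThan_Suc)
  finally show ?thesis .
qed

lemma L_power_col_sum:
  assumes "j \<le> k"
  shows "(\<Sum>i<k. L_power l k $$ (i, j) * f i) =
    (if j = 0 then 0 else monom 1 l * f (j - 1)) - (if j < k then f j else 0)"
proof -
  have "(\<Sum>i<k. L_power l k $$ (i, j) * f i) =
      (\<Sum>i<k. (if i = j then - f i else 0) + (if i = j - 1 then (if j = 0 then 0 else monom 1 l * f i) else 0))"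
    using assms by (intro sum.cong refl) (auto simp: L_power_eq)
  also have "\<dots> = (if j = 0 then 0 else monom 1 l * f (j - 1)) - (if j < k then f j else 0)"
    using assms by (auto simp: sum.distrib)
  finally show ?thesis .
qed

lemma L_power_Lambda_power: "L_power l k * Lambda_power l k = (0\<^sub>m k 1 :: 'a::field poly mat)"
proof (rule eq_matI)
  fix i j :: nat assume *: "i < dim_row (0\<^sub>m k 1 :: 'a poly mat)" "j < dim_col (0\<^sub>m k 1 :: 'a poly mat)"
  then have "(L_power l k * Lambda_power l k :: 'a poly mat) $$ (i, j) =
      (\<Sum>m<k + 1. L_power l k $$ (i, m) * Lambda_power l k $$ (m, 0))"
    by (simp add: scalar_prod_def atLeast0LessThan del: sum.lessThan_Suc)
  also have "\<dots> = 0"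
    using * by (simp only: L_power_row_sum index_zero_mat)
      (simp add: Lambda_power_eq mult_monom Suc_diff_Suc flip: mult_Suc_right)
  finally show "(L_power l k * Lambda_power l k :: 'a poly mat) $$ (i, j) = 0\<^sub>m k 1 $$ (i, j)" using * by simp
qed simp_all

text \<open>
  Substituting back satisfies every equation of the bidiagonal system but the last; the residual in
  the last row is the pairing with \<open>\<Lambda>\<^sub>k(\<mu>)\<close>, which is the solvability condition of the system.
\<close>

lemma transpose_L_power_back_subst:
  "transpose_mat (L_power l k) * back_subst l k + 1\<^sub>m (k + 1) =
    (transpose_mat (last_unit_row k) * transpose_mat (Lambda_power l k) :: 'a::field poly mat)"
  (is "?L * ?T + _ = ?R")
proof (rule eq_matI)
  fix i j assume "i < dim_row ?R" "j < dim_col ?R"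
  then have *: "i \<le> k" "j \<le> k" by simp_all
  have "(?L * ?T) $$ (i, j) = (\<Sum>m<k. L_power l k $$ (m, i) * back_subst l k $$ (m, j))"
    using * by (simp add: scalar_prod_def atLeast0LessThan)
  also have "\<dots> = (if i = 0 then 0 else monom 1 l * back_subst l k $$ (i - 1, j))
      - (if i < k then back_subst l k $$ (i, j) else 0)"
    using * by (rule_tac L_power_col_sum)
  also have "\<dots> = (if i = k then monom 1 (l * (k - j)) else 0) - (if i = j then 1 else 0)"
    using * by (cases i) (auto simp: back_subst_def mult_monom Suc_diff_le simp flip: one_poly_eq_simps)
  finally have "(?L * ?T) $$ (i, j) = \<dots>" .
  moreover have "?R $$ (i, j) = (if i = k then monom 1 (l * (k - j)) else 0)"
    using * by (simp add: scalar_prod_def last_unit_row_def Lambda_power_eq)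
  ultimately show "(?L * ?T + 1\<^sub>m (k + 1)) $$ (i, j) = ?R $$ (i, j)"
    using * by simp
qed simp_all

lemma back_subst_transpose_L_power:
  "back_subst l k * transpose_mat (L_power l k) + 1\<^sub>m k = (0\<^sub>m k k :: 'a::field poly mat)"
  (is "?T * ?L + _ = ?R")
proof (rule eq_matI)
  fix i j assume "i < dim_row ?R" "j < dim_col ?R"
  then have *: "i < k" "j < k" by simp_all
  have "(?T * ?L) $$ (i, j) = (\<Sum>m<k + 1. L_power l k $$ (j, m) * back_subst l k $$ (i, m))"
    using * by (simp add: scalar_prod_def atLeast0LessThan mult.commute del: sum.lessThan_Suc)
  also have "\<dots> = monom 1 l * back_subst l k $$ (i, j + 1) - back_subst l k $$ (i, j)"
    using * by (rule_tac L_power_row_sum)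
  also have "\<dots> = (if i = j then - 1 else 0)"
    using * by (auto simp: back_subst_def mult_monom Suc_diff_Suc simp flip: mult_Suc_right one_poly_eq_simps)
  finally show "(?T * ?L + 1\<^sub>m k) $$ (i, j) = ?R $$ (i, j)" using * by simp
qed simp_all

lemma last_unit_row_Lambda_power: "last_unit_row k * Lambda_power l k = (1\<^sub>m 1 :: 'a::field poly mat)"
  by (rule eq_matI) (auto simp: scalar_prod_def last_unit_row_def Lambda_power_eq simp flip: one_poly_eq_simps)

lemma last_unit_row_transpose: "last_unit_row k * transpose_mat (last_unit_row k) = (1\<^sub>m 1 :: 'a::field poly mat)"
  by (rule eq_matI) (auto simp: scalar_prod_def last_unit_row_def)

section \<open>Reduction of a block pencil to its compression\<close>

lemma append_rows_mult:
  fixes A B C :: "'b::comm_ring_1 mat"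
  assumes A: "A \<in> carrier_mat p r" and B: "B \<in> carrier_mat q r" and C: "C \<in> carrier_mat r c"
  shows "(A @\<^sub>r B) * C = (A * C) @\<^sub>r (B * C)"
proof (rule eq_matI)
  show "dim_row ((A @\<^sub>r B) * C) = dim_row ((A * C) @\<^sub>r (B * C))"
    and "dim_col ((A @\<^sub>r B) * C) = dim_col ((A * C) @\<^sub>r (B * C))"
    using A B C by (simp_all add: append_rows_def)
  fix i j assume ij: "i < dim_row ((A * C) @\<^sub>r (B * C))" "j < dim_col ((A * C) @\<^sub>r (B * C))"
  have col: "col C j \<in> carrier_vec r" using C by (metis col_dim carrier_matD(1))
  have "((A @\<^sub>r B) * C) $$ (i, j) = ((A @\<^sub>r B) *\<^sub>v col C j) $ i"
    using A B C ij by (simp add: append_rows_def)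
  also have "\<dots> = ((A * C) @\<^sub>r (B * C)) $$ (i, j)"
    unfolding mat_mult_append[OF A B col]
    using A B C ij by (simp add: append_rows_def)
  finally show "((A @\<^sub>r B) * C) $$ (i, j) = ((A * C) @\<^sub>r (B * C)) $$ (i, j)" .
qed

lemma four_block_mult_append_rows:
  fixes A B C D X Y :: "'b::comm_ring_1 mat"
  assumes A: "A \<in> carrier_mat p q" and B: "B \<in> carrier_mat p a"
    and C: "C \<in> carrier_mat b q" and D: "D \<in> carrier_mat b a"
    and X: "X \<in> carrier_mat q n" and Y: "Y \<in> carrier_mat a n"
  shows "four_block_mat A B C D * (X @\<^sub>r Y) = (A * X + B * Y) @\<^sub>r (C * X + D * Y)"
  unfolding append_rows_def carrier_matD[OF X] carrier_matD[OF Y]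
  by (simp only: mult_four_block_mat[OF A B C D X zero_carrier_mat Y zero_carrier_mat]
      right_mult_zero_mat[OF A] right_mult_zero_mat[OF B] right_mult_zero_mat[OF C]
      right_mult_zero_mat[OF D] right_add_zero_mat[OF zero_carrier_mat])
    (use A B C D X Y in simp)

lemma four_block_append_cols:
  fixes X :: "'b::comm_ring_1 mat"
  assumes X: "X \<in> carrier_mat n q" and Y: "Y \<in> carrier_mat n a"
    and Z: "Z \<in> carrier_mat q r" and W: "W \<in> carrier_mat a r"
  shows "four_block_mat X Y (0\<^sub>m 0 q) (0\<^sub>m 0 a) * (Z @\<^sub>r W) = X * Z + Y * W"
  by (subst four_block_mult_append_rows[OF X Y zero_carrier_mat zero_carrier_mat Z W])
    (use X Y Z W in \<open>auto simp: append_rows_def intro!: eq_matI\<close>)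

text \<open>
  The properties of the Kronecker blocks from which the nullspace of the pencil can be computed, free of
  any block structure.  For block Kronecker matrices \<open>A1\<close> is \<open>L\<^sub>\<eta>(\<mu>)\<^sup>T \<otimes> I\<close> and \<open>A2\<close> is
  \<open>L\<^sub>\<epsilon>(\<mu>) \<otimes> I\<close>; \<open>T1\<close> and \<open>T2\<close> come from the substitution operator and its transpose, \<open>r1\<close> and \<open>c2\<close> from
  \<open>\<Lambda>\<^sub>\<eta>(\<mu>)\<^sup>T\<close> and \<open>\<Lambda>\<^sub>\<epsilon>(\<mu>)\<close>, while \<open>s1\<close>, \<open>u1\<close> and \<open>u2\<close> place or select a last block.
  The compression \<open>r1 * M * c2\<close> is then \<open>P\<close>.

  The identity for \<open>T2 * A2\<close> says that the kernel of \<open>A2\<close> is the range of \<open>c2\<close>, parametrized by \<open>u2\<close>.  Those for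
  \<open>A1 * T1\<close> and \<open>T1 * A1\<close> say that \<open>A1 * y = w\<close> is solvable if \<open>r1 * w = 0\<close>, and that \<open>y = - T1 * w\<close> is then the
  only solution.
\<close>

locale dual_block_pencil =
  fixes M A1 A2 T1 T2 s1 r1 u1 c2 u2 :: "'b::comm_ring_1 mat"
    and p q a b m n :: nat
  assumes M: "M \<in> carrier_mat p q" and A1: "A1 \<in> carrier_mat p a" and A2: "A2 \<in> carrier_mat b q"
    and T1: "T1 \<in> carrier_mat a p" and T2: "T2 \<in> carrier_mat q b"
    and s1: "s1 \<in> carrier_mat p m" and r1: "r1 \<in> carrier_mat m p" and u1: "u1 \<in> carrier_mat m p"
    and c2: "c2 \<in> carrier_mat q n" and u2: "u2 \<in> carrier_mat n q"
    and A1T1: "A1 * T1 + 1\<^sub>m p = s1 * r1" and T1A1: "T1 * A1 + 1\<^sub>m a = 0\<^sub>m a a"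
    and u1s1: "u1 * s1 = 1\<^sub>m m"
    and A2c2: "A2 * c2 = 0\<^sub>m b n" and T2A2: "T2 * A2 + 1\<^sub>m q = c2 * u2"
    and u2c2: "u2 * c2 = 1\<^sub>m n"
begin

definition "pencil = four_block_mat M A1 A2 (0\<^sub>m b a)"
definition "lift = c2 @\<^sub>r (T1 * (M * c2))"
definition "proj = four_block_mat u2 (0\<^sub>m n a) (0\<^sub>m 0 q) (0\<^sub>m 0 a)"
definition "inject = s1 @\<^sub>r 0\<^sub>m b m"
definition "uninject = four_block_mat u1 (0\<^sub>m m b) (0\<^sub>m 0 p) (0\<^sub>m 0 b)"
text \<open>
  The cofactor of \<open>pencil\<close> in \<open>lift * proj - 1\<close>; being a multiple of the pencil, this difference vanishes
  on the nullspace of the pencil.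
\<close>

definition "correction = four_block_mat (0\<^sub>m q p) T2 T1 (T1 * M * T2)"

lemma carriers:
  "pencil \<in> carrier_mat (p + b) (q + a)"
  "lift \<in> carrier_mat (q + a) n"
  "proj \<in> carrier_mat n (q + a)"
  "inject \<in> carrier_mat (p + b) m"
  "uninject \<in> carrier_mat m (p + b)"
  "correction \<in> carrier_mat (q + a) (p + b)"
  unfolding pencil_def lift_def proj_def inject_def uninject_def correction_def
  using M A1 A2 T1 T2 s1 u1 c2 u2 by auto

lemma proj_lift: "proj * lift = 1\<^sub>m n"
proof -
  have N: "T1 * (M * c2) \<in> carrier_mat a n" using T1 M c2 by auto
  show ?thesis
    unfolding proj_def lift_def
    using four_block_append_cols[OF u2 zero_carrier_mat c2 N] by (simp add: u2c2 left_mult_zero_mat[OF N])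
qed

lemma uninject_inject: "uninject * inject = 1\<^sub>m m"
  unfolding uninject_def inject_def
  using four_block_append_cols[OF u1 zero_carrier_mat s1 zero_carrier_mat] u1s1 by simp

lemma pencil_lift: "pencil * lift = inject * (r1 * M * c2)"
proof -
  let ?W = "M * c2"
  have W: "?W \<in> carrier_mat p n" and N: "T1 * ?W \<in> carrier_mat a n" using T1 M c2 by auto
  have P: "r1 * ?W \<in> carrier_mat m n" using r1 W by simp
  have "pencil * lift = (?W + A1 * (T1 * ?W)) @\<^sub>r (A2 * c2 + 0\<^sub>m b a * (T1 * ?W))"
    unfolding pencil_def lift_def by (rule four_block_mult_append_rows[OF M A1 A2 zero_carrier_mat c2 N])
  also have "A2 * c2 + 0\<^sub>m b a * (T1 * ?W) = 0\<^sub>m b n" by (simp add: A2c2 left_mult_zero_mat[OF N])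
  also have "?W + A1 * (T1 * ?W) = (A1 * T1 + 1\<^sub>m p) * ?W"
  proof -
    have "(A1 * T1 + 1\<^sub>m p) * ?W = A1 * (T1 * ?W) + ?W"
      by (simp only: add_mult_distrib_mat[OF mult_carrier_mat[OF A1 T1] one_carrier_mat W]
          assoc_mult_mat[OF A1 T1 W] left_mult_one_mat[OF W])
    then show ?thesis by (simp only: comm_add_mat[OF W mult_carrier_mat[OF A1 N]])
  qed
  also have "\<dots> = s1 * (r1 * ?W)" by (simp only: A1T1 assoc_mult_mat[OF s1 r1 W])
  also have "\<dots> @\<^sub>r 0\<^sub>m b n = inject * (r1 * ?W)"
    unfolding inject_def by (simp only: append_rows_mult[OF s1 zero_carrier_mat P] left_mult_zero_mat[OF P])
  finally show ?thesis by (simp only: assoc_mult_mat[OF r1 M c2])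
qed

lemma lift_proj: "lift * proj = 1\<^sub>m (q + a) + correction * pencil"
proof -
  let ?N = "T1 * (M * c2)"
  have N: "?N \<in> carrier_mat a n" using T1 M c2 by auto
  have TMT: "T1 * M * T2 \<in> carrier_mat a b" using T1 M T2 by auto
  have TMTA: "T1 * M + T1 * M * T2 * A2 \<in> carrier_mat a q"
    by (rule add_carrier_mat[OF mult_carrier_mat[OF TMT A2]])
  have TM: "T1 * M \<in> carrier_mat a q" using T1 M by simp
  have TA: "T2 * A2 \<in> carrier_mat q q" using T2 A2 by simp
  have "lift * proj = four_block_mat (c2 * u2) (0\<^sub>m q a) (?N * u2) (0\<^sub>m a a)"
    unfolding lift_def proj_def append_rows_def carrier_matD[OF c2] carrier_matD[OF N]
    by (simp only: mult_four_block_mat[OF c2 zero_carrier_mat N zero_carrier_mat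
          u2 zero_carrier_mat zero_carrier_mat zero_carrier_mat]
        left_mult_zero_mat[OF zero_carrier_mat] right_mult_zero_mat[OF c2] right_mult_zero_mat[OF N]
        right_add_zero_mat[OF zero_carrier_mat] right_add_zero_mat[OF mult_carrier_mat[OF c2 u2]]
        right_add_zero_mat[OF mult_carrier_mat[OF N u2]])
  also have "?N * u2 = T1 * M * (T2 * A2 + 1\<^sub>m q)"
    by (simp only: T2A2 assoc_mult_mat[OF T1 mult_carrier_mat[OF M c2] u2] assoc_mult_mat[OF M c2 u2]
        assoc_mult_mat[OF T1 M mult_carrier_mat[OF c2 u2]])
  also have "\<dots> = T1 * M * T2 * A2 + T1 * M"
    by (simp only: mult_add_distrib_mat[OF TM TA one_carrier_mat] assoc_mult_mat[OF TM T2 A2]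
        right_mult_one_mat[OF TM])
  also have "\<dots> = T1 * M + T1 * M * T2 * A2"
    by (rule comm_add_mat[OF mult_carrier_mat[OF TMT A2] TM])
  finally have lhs: "lift * proj = four_block_mat (T2 * A2 + 1\<^sub>m q) (0\<^sub>m q a)
      (T1 * M + T1 * M * T2 * A2) (0\<^sub>m a a)" by (simp only: T2A2)
  have "correction * pencil = four_block_mat (T2 * A2) (0\<^sub>m q a) (T1 * M + T1 * M * T2 * A2) (T1 * A1)"
    unfolding correction_def pencil_def
    by (simp only: mult_four_block_mat[OF zero_carrier_mat T2 T1 TMT M A1 A2 zero_carrier_mat]
        left_mult_zero_mat[OF M] left_mult_zero_mat[OF A1] right_mult_zero_mat[OF T2]
        right_mult_zero_mat[OF TMT] right_add_zero_mat[OF zero_carrier_mat]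
        left_add_zero_mat[OF TA] right_add_zero_mat[OF mult_carrier_mat[OF T1 A1]])
  moreover have "1\<^sub>m (q + a) = (four_block_mat (1\<^sub>m q) (0\<^sub>m q a) (0\<^sub>m a q) (1\<^sub>m a) :: 'b mat)"
    by simp
  ultimately have "1\<^sub>m (q + a) + correction * pencil = four_block_mat (1\<^sub>m q + T2 * A2) (0\<^sub>m q a + 0\<^sub>m q a)
      (0\<^sub>m a q + (T1 * M + T1 * M * T2 * A2)) (1\<^sub>m a + T1 * A1)"
    using add_four_block_mat[OF one_carrier_mat zero_carrier_mat zero_carrier_mat one_carrier_mat
        TA zero_carrier_mat TMTA mult_carrier_mat[OF T1 A1]] by (simp only:)
  also have "\<dots> = four_block_mat (T2 * A2 + 1\<^sub>m q) (0\<^sub>m q a)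
      (T1 * M + T1 * M * T2 * A2) (0\<^sub>m a a)"
  proof (rule cong_four_block_mat)
    show "1\<^sub>m q + T2 * A2 = T2 * A2 + 1\<^sub>m q" using TA by (intro comm_add_mat) auto
    have "1\<^sub>m a + T1 * A1 = T1 * A1 + 1\<^sub>m a" using T1 A1 by (intro comm_add_mat) auto
    then show "1\<^sub>m a + T1 * A1 = 0\<^sub>m a a" by (simp only: T1A1)
  qed (simp_all only: left_add_zero_mat[OF TMTA] left_add_zero_mat[OF zero_carrier_mat])
  finally show ?thesis using lhs by simp
qed

end

section \<open>Degrees of polynomial vectors\<close>

lemma vec_degree_le_iff: "vec_degree v \<le> D \<longleftrightarrow> (\<forall>i<dim_vec v. degree (v $ i) \<le> D)"
proof -
  have "finite (insert 0 (degree ` set\<^sub>v v))" by (simp add: vec_set_def)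
  then show ?thesis unfolding vec_degree_def by (subst Max_le_iff) (auto simp: vec_set_def)
qed

text \<open>
  Nonvanishing of the entry has to be claimed separately, since \<open>0\<close> has degree \<open>0\<close> and would
  otherwise be a possible witness when the vector is constant.
\<close>

lemma vec_degree_attained:
  assumes "v \<in> carrier_vec n" "v \<noteq> 0\<^sub>v n"
  obtains i where "i < n" "v $ i \<noteq> 0" "degree (v $ i) = vec_degree v"
proof -
  have le: "degree (v $ i) \<le> vec_degree v" if "i < n" for i
    using that assms(1) vec_degree_le_iff[of v "vec_degree v"] by auto
  obtain k where k: "k < n" "v $ k \<noteq> 0" using assms by (metis eq_vecI carrier_vecD index_zero_vec)
  show thesis
  proof (cases "vec_degree v = 0")
    case True
    then show thesis using that[of k] k le[of k] by simp
  next
    case False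
    have "vec_degree v \<in> insert 0 (degree ` set\<^sub>v v)"
      unfolding vec_degree_def by (rule Max_in) (simp_all add: vec_set_def)
    then obtain i where "i < n" "degree (v $ i) = vec_degree v"
      using False assms(1) by (auto simp: vec_set_def)
    then show thesis using that[of i] False by (metis degree_0)
  qed
qed

lemma has_grade_degree_le:
  assumes "has_grade g M" "i < dim_row M" "j < dim_col M"
  shows "degree (M $$ (i, j)) \<le> g"
proof -
  obtain C :: "nat \<Rightarrow> 'a mat" where
    C: "M = mat (dim_row M) (dim_col M) (\<lambda>rc. \<Sum>i\<le>g. monom (C i $$ rc) i)"
    using assms(1) unfolding has_grade_def by blast
  have "M $$ (i, j) = (\<Sum>k\<le>g. monom (C k $$ (i, j)) k)"
    by (subst C) (use assms in simp)
  also have "degree \<dots> \<le> g"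
    by (rule degree_sum_le) (auto intro: order_trans[OF degree_monom_le])
  finally show ?thesis .
qed

lemma degree_mult_mat_vec_le:
  assumes "M \<in> carrier_mat r c" "x \<in> carrier_vec c" "i < r"
    and "\<And>j. j < c \<Longrightarrow> degree (M $$ (i, j)) \<le> g" "\<And>j. j < c \<Longrightarrow> degree (x $ j) \<le> D"
  shows "degree ((M *\<^sub>v x) $ i) \<le> g + D"
proof -
  have "(M *\<^sub>v x) $ i = (\<Sum>j<c. M $$ (i, j) * x $ j)"
    using assms(1-3) by (simp add: scalar_prod_def atLeast0LessThan)
  also have "degree \<dots> \<le> g + D"
  proof (rule degree_sum_le)
    fix j assume "j \<in> {..<c}"
    then have "degree (M $$ (i, j)) + degree (x $ j) \<le> g + D"
      using assms(4,5) by (intro add_mono) auto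
    then show "degree (M $$ (i, j) * x $ j) \<le> g + D"
      by (rule order_trans[OF degree_mult_le])
  qed simp
  finally show ?thesis .
qed

section \<open>Right minimal indices of block Kronecker matrices\<close>

lemma dual_block_kronecker:
  fixes M :: "'a::field poly mat"
  assumes M: "M \<in> carrier_mat ((\<eta> + 1) * m) ((\<epsilon> + 1) * n)"
  shows "dual_block_pencil M
    (transpose_mat (L_power l \<eta>) \<otimes>\<^sub>K 1\<^sub>m m) (L_power l \<epsilon> \<otimes>\<^sub>K 1\<^sub>m n)
    (back_subst l \<eta> \<otimes>\<^sub>K 1\<^sub>m m) (transpose_mat (back_subst l \<epsilon>) \<otimes>\<^sub>K 1\<^sub>m n)
    (transpose_mat (last_unit_row \<eta>) \<otimes>\<^sub>K 1\<^sub>m m) (transpose_mat (Lambda_power l \<eta>) \<otimes>\<^sub>K 1\<^sub>m m)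
    (last_unit_row \<eta> \<otimes>\<^sub>K 1\<^sub>m m)
    (Lambda_power l \<epsilon> \<otimes>\<^sub>K 1\<^sub>m n) (last_unit_row \<epsilon> \<otimes>\<^sub>K 1\<^sub>m n)
    ((\<eta> + 1) * m) ((\<epsilon> + 1) * n) (\<eta> * m) (\<epsilon> * n) m n"
proof
  have kr: "(A \<otimes>\<^sub>K 1\<^sub>m t) \<in> carrier_mat (r * t) (c * t)" if "A \<in> carrier_mat r c"
    for A :: "'a poly mat" and r c t using that by (intro kronecker_carrier one_carrier_mat)
  have kr1: "(A \<otimes>\<^sub>K 1\<^sub>m t) \<in> carrier_mat t (c * t)" if "A \<in> carrier_mat 1 c"
    for A :: "'a poly mat" and c t using kr[OF that, of t] by simp
  have kr2: "(A \<otimes>\<^sub>K 1\<^sub>m t) \<in> carrier_mat (r * t) t" if "A \<in> carrier_mat r 1"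
    for A :: "'a poly mat" and r t using kr[OF that, of t] by simp
  have tr: "transpose_mat A \<in> carrier_mat c r" if "A \<in> carrier_mat r c"
    for A :: "'a poly mat" and r c using that by simp
  note inn = inner_carriers
  note km = kronecker_one_mult
  show "M \<in> carrier_mat ((\<eta> + 1) * m) ((\<epsilon> + 1) * n)" by (rule M)
  show "(transpose_mat (L_power l \<eta>) \<otimes>\<^sub>K 1\<^sub>m m :: 'a poly mat) \<in> carrier_mat ((\<eta> + 1) * m) (\<eta> * m)"
    by (intro kr tr inn)
  show "(L_power l \<epsilon> \<otimes>\<^sub>K 1\<^sub>m n :: 'a poly mat) \<in> carrier_mat (\<epsilon> * n) ((\<epsilon> + 1) * n)" by (intro kr tr inn)
  show "(back_subst l \<eta> \<otimes>\<^sub>K 1\<^sub>m m :: 'a poly mat) \<in> carrier_mat (\<eta> * m) ((\<eta> + 1) * m)" by (intro kr tr inn)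
  show "(transpose_mat (back_subst l \<epsilon>) \<otimes>\<^sub>K 1\<^sub>m n :: 'a poly mat) \<in> carrier_mat ((\<epsilon> + 1) * n) (\<epsilon> * n)" by (intro kr tr inn)
  show "(transpose_mat (last_unit_row \<eta>) \<otimes>\<^sub>K 1\<^sub>m m :: 'a poly mat) \<in> carrier_mat ((\<eta> + 1) * m) m" by (intro kr2 tr inn)
  show "(transpose_mat (Lambda_power l \<eta>) \<otimes>\<^sub>K 1\<^sub>m m :: 'a poly mat) \<in> carrier_mat m ((\<eta> + 1) * m)" by (intro kr1 tr inn)
  show "(last_unit_row \<eta> \<otimes>\<^sub>K 1\<^sub>m m :: 'a poly mat) \<in> carrier_mat m ((\<eta> + 1) * m)" by (intro kr1 tr inn)
  show "(Lambda_power l \<epsilon> \<otimes>\<^sub>K 1\<^sub>m n :: 'a poly mat) \<in> carrier_mat ((\<epsilon> + 1) * n) n" by (intro kr2 tr inn)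
  show "(last_unit_row \<epsilon> \<otimes>\<^sub>K 1\<^sub>m n :: 'a poly mat) \<in> carrier_mat n ((\<epsilon> + 1) * n)" by (intro kr1 tr inn)
  show "(transpose_mat (L_power l \<eta>) \<otimes>\<^sub>K 1\<^sub>m m) * (back_subst l \<eta> \<otimes>\<^sub>K 1\<^sub>m m) + 1\<^sub>m ((\<eta> + 1) * m) =
      (transpose_mat (last_unit_row \<eta>) \<otimes>\<^sub>K 1\<^sub>m m) * (transpose_mat (Lambda_power l \<eta>) \<otimes>\<^sub>K 1\<^sub>m m :: 'a poly mat)"
    by (simp only: km[OF tr[OF inn(1)] inn(3)] km[OF tr[OF inn(4)] tr[OF inn(2)]]
        kronecker_one_add[OF mult_carrier_mat[OF tr[OF inn(1)] inn(3)] one_carrier_mat, symmetric]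
        kronecker_one_one[symmetric] transpose_L_power_back_subst)
  show "(back_subst l \<eta> \<otimes>\<^sub>K 1\<^sub>m m) * (transpose_mat (L_power l \<eta>) \<otimes>\<^sub>K 1\<^sub>m m) + 1\<^sub>m (\<eta> * m) =
      (0\<^sub>m (\<eta> * m) (\<eta> * m) :: 'a poly mat)"
    by (simp only: km[OF inn(3) tr[OF inn(1)]]
        kronecker_one_add[OF mult_carrier_mat[OF inn(3) tr[OF inn(1)]] one_carrier_mat, symmetric]
        kronecker_one_one[symmetric] back_subst_transpose_L_power kronecker_zero_one)
  show "(last_unit_row \<eta> \<otimes>\<^sub>K 1\<^sub>m m) * (transpose_mat (last_unit_row \<eta>) \<otimes>\<^sub>K 1\<^sub>m m) = (1\<^sub>m m :: 'a poly mat)"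
    by (simp only: km[OF inn(4) tr[OF inn(4)]] last_unit_row_transpose kronecker_one_one mult_1)
  show "(L_power l \<epsilon> \<otimes>\<^sub>K 1\<^sub>m n) * (Lambda_power l \<epsilon> \<otimes>\<^sub>K 1\<^sub>m n) = (0\<^sub>m (\<epsilon> * n) n :: 'a poly mat)"
    by (simp only: km[OF inn(1) inn(2)] L_power_Lambda_power kronecker_zero_one mult_1)
  have "transpose_mat (back_subst l \<epsilon>) * L_power l \<epsilon> + 1\<^sub>m (\<epsilon> + 1)
      = transpose_mat (transpose_mat (L_power l \<epsilon>) * back_subst l \<epsilon> + 1\<^sub>m (\<epsilon> + 1) :: 'a poly mat)"
    by (simp only: transpose_add[OF mult_carrier_mat[OF tr[OF inn(1)] inn(3)] one_carrier_mat]
        transpose_mult[OF tr[OF inn(1)] inn(3)] transpose_transpose transpose_one)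
  also have "\<dots> = Lambda_power l \<epsilon> * last_unit_row \<epsilon>"
    by (simp only: transpose_L_power_back_subst transpose_mult[OF tr[OF inn(4)] tr[OF inn(2)]] transpose_transpose)
  finally have T: "transpose_mat (back_subst l \<epsilon>) * L_power l \<epsilon> + 1\<^sub>m (\<epsilon> + 1) =
      (Lambda_power l \<epsilon> * last_unit_row \<epsilon> :: 'a poly mat)" .
  show "(transpose_mat (back_subst l \<epsilon>) \<otimes>\<^sub>K 1\<^sub>m n) * (L_power l \<epsilon> \<otimes>\<^sub>K 1\<^sub>m n) + 1\<^sub>m ((\<epsilon> + 1) * n) =
      (Lambda_power l \<epsilon> \<otimes>\<^sub>K 1\<^sub>m n) * (last_unit_row \<epsilon> \<otimes>\<^sub>K 1\<^sub>m n :: 'a poly mat)"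
    by (simp only: km[OF tr[OF inn(3)] inn(1)] km[OF inn(2) inn(4)]
        kronecker_one_add[OF mult_carrier_mat[OF tr[OF inn(3)] inn(1)] one_carrier_mat, symmetric]
        kronecker_one_one[symmetric] T)
  show "(last_unit_row \<epsilon> \<otimes>\<^sub>K 1\<^sub>m n) * (Lambda_power l \<epsilon> \<otimes>\<^sub>K 1\<^sub>m n) = (1\<^sub>m n :: 'a poly mat)"
    by (simp only: km[OF inn(4) inn(2)] last_unit_row_Lambda_power kronecker_one_one mult_1)
qed

lemma block_kronecker_right_minimal_indices:
  fixes M P :: "'a::field poly mat"
  assumes M: "M \<in> carrier_mat ((\<eta> + 1) * m) ((\<epsilon> + 1) * n)"
    and grade: "has_grade l M"
    and P: "P = (transpose_mat (eval_at_power l (Lambda_col \<eta>)) \<otimes>\<^sub>K 1\<^sub>m m) * M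
               * (eval_at_power l (Lambda_col \<epsilon>) \<otimes>\<^sub>K 1\<^sub>m n)"
    and ind: "right_minimal_indices P es"
  shows "right_minimal_indices (block_kronecker \<epsilon> n \<eta> m l M) (map (\<lambda>e. e + \<epsilon> * l) es)"
proof -
  define p where "p = (\<eta> + 1) * m"
  define q where "q = (\<epsilon> + 1) * n"
  define A1 :: "'a poly mat" where "A1 = transpose_mat (L_power l \<eta>) \<otimes>\<^sub>K 1\<^sub>m m"
  define A2 :: "'a poly mat" where "A2 = L_power l \<epsilon> \<otimes>\<^sub>K 1\<^sub>m n"
  define T1 :: "'a poly mat" where "T1 = back_subst l \<eta> \<otimes>\<^sub>K 1\<^sub>m m"
  define T2 :: "'a poly mat" where "T2 = transpose_mat (back_subst l \<epsilon>) \<otimes>\<^sub>K 1\<^sub>m n"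
  define r1 :: "'a poly mat" where "r1 = transpose_mat (Lambda_power l \<eta>) \<otimes>\<^sub>K 1\<^sub>m m"
  define c2 :: "'a poly mat" where "c2 = Lambda_power l \<epsilon> \<otimes>\<^sub>K 1\<^sub>m n"
  interpret dual_block_pencil M A1 A2 T1 T2
    "transpose_mat (last_unit_row \<eta>) \<otimes>\<^sub>K 1\<^sub>m m" r1 "last_unit_row \<eta> \<otimes>\<^sub>K 1\<^sub>m m"
    c2 "last_unit_row \<epsilon> \<otimes>\<^sub>K 1\<^sub>m n" p q "\<eta> * m" "\<epsilon> * n" m n
    unfolding A1_def A2_def T1_def T2_def r1_def c2_def p_def q_def
    by (rule dual_block_kronecker[OF M])
  have P': "P = r1 * M * c2"
    unfolding P r1_def c2_def Lambda_power_def ..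
  have pencil: "block_kronecker \<epsilon> n \<eta> m l M = pencil"
    by (simp only: block_kronecker_def L_power_def[symmetric] A1_def[symmetric] A2_def[symmetric] pencil_def)
  have Pc: "P \<in> carrier_mat m n"
    unfolding P' by (rule mult_carrier_mat[OF mult_carrier_mat[OF r1 M] c2])
  have N: "T1 * (M * c2) \<in> carrier_mat (\<eta> * m) n"
    by (rule mult_carrier_mat[OF T1 mult_carrier_mat[OF M c2]])
  have degree_lift: "vec_degree (lift *\<^sub>v v) = vec_degree v + \<epsilon> * l"
    if v: "v \<in> carrier_vec n" "v \<noteq> 0\<^sub>v n" and Pv: "P *\<^sub>v v = 0\<^sub>v m" for v
  proof -
    define x where "x = c2 *\<^sub>v v"
    define y where "y = T1 * (M * c2) *\<^sub>v v"
    define D where "D = vec_degree v + \<epsilon> * l"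
    have x: "x \<in> carrier_vec q" unfolding x_def by (rule mult_mat_vec_carrier[OF c2 v(1)])
    have y: "y \<in> carrier_vec (\<eta> * m)" unfolding y_def by (rule mult_mat_vec_carrier[OF N v(1)])
    have Zv: "lift *\<^sub>v v = x @\<^sub>v y"
      unfolding lift_def x_def y_def by (rule mat_mult_append[OF c2 N v(1)])
    have v_le: "degree (v $ a) \<le> vec_degree v" if "a < n" for a
      using vec_degree_le_iff[of v "vec_degree v"] that v by auto
    have x_index: "x $ (i * n + a) = monom 1 (l * (\<epsilon> - i)) * v $ a" if "i < \<epsilon> + 1" "a < n" for i a
      unfolding x_def c2_def
      using kronecker_one_mult_vec_index[of "Lambda_power l \<epsilon>" "\<epsilon> + 1" 1 v n i a] that v
      by (simp add: Lambda_power_eq)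
    have x_le: "degree (x $ k) \<le> D" if "k < q" for k
    proof -
      have "k div n < \<epsilon> + 1" using that unfolding q_def by (rule less_mult_imp_div_less)
      moreover have a: "k mod n < n" using that unfolding q_def by (intro mod_less_divisor) (auto intro: Nat.gr0I)
      ultimately have "x $ k = monom 1 (l * (\<epsilon> - k div n)) * v $ (k mod n)"
        using x_index[of "k div n" "k mod n"] by simp
      also have "degree \<dots> \<le> l * (\<epsilon> - k div n) + vec_degree v"
        by (intro order_trans[OF degree_mult_le] add_mono degree_monom_le v_le a)
      also have "\<dots> \<le> D" unfolding D_def by (simp add: mult.commute[of l])
      finally show ?thesis .
    qed
    have top: "M *\<^sub>v x + A1 *\<^sub>v y = 0\<^sub>v p"
    proof -
      have "(M *\<^sub>v x + A1 *\<^sub>v y) @\<^sub>v (A2 *\<^sub>v x + 0\<^sub>m (\<epsilon> * n) (\<eta> * m) *\<^sub>v y) = pencil *\<^sub>v (lift *\<^sub>v v)"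
        unfolding Zv pencil_def by (rule four_block_mat_mult_vec[OF M A1 A2 _ x y, symmetric]) simp
      also have "\<dots> = inject *\<^sub>v (P *\<^sub>v v)"
        using v(1) by (metis P' pencil_lift assoc_mult_mat_vec carriers(1,2,4) Pc)
      also have "\<dots> = 0\<^sub>v p @\<^sub>v 0\<^sub>v (\<epsilon> * n)"
        unfolding Pv mult_mat_vec_zero[OF carriers(4)] by (intro eq_vecI) auto
      finally show ?thesis
        using append_vec_eq[OF add_carrier_vec[OF mult_mat_vec_carrier[OF M x] mult_mat_vec_carrier[OF A1 y]]
            zero_carrier_vec] by simp
    qed
    \<comment> \<open>block row \<open>i + 1\<close> of \<open>M x + A1 y = 0\<close>, read as an equation for block \<open>i\<close> of \<open>y\<close>\<close>
    have y_step: "monom 1 l * y $ (i * m + a) =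
        (if i + 1 < \<eta> then y $ ((i + 1) * m + a) else 0) - (M *\<^sub>v x) $ ((i + 1) * m + a)"
      if i: "i < \<eta>" and a: "a < m" for i a
    proof -
      have k: "(i + 1) * m + a < p" unfolding p_def using i a by (intro kronecker_index_less) auto
      have "(A1 *\<^sub>v y) $ ((i + 1) * m + a) =
          (\<Sum>j<\<eta>. transpose_mat (L_power l \<eta>) $$ (i + 1, j) * y $ (j * m + a))"
        unfolding A1_def using i a y
        by (intro kronecker_one_mult_vec_index[of _ "\<eta> + 1"]) auto
      also have "\<dots> = (\<Sum>j<\<eta>. L_power l \<eta> $$ (j, i + 1) * y $ (j * m + a))"
        using i by (intro sum.cong) auto
      also have "\<dots> = monom 1 l * y $ (i * m + a) - (if i + 1 < \<eta> then y $ ((i + 1) * m + a) else 0)"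
        using i L_power_col_sum[of "i + 1" \<eta> l "\<lambda>j. y $ (j * m + a)"] by simp
      finally have *: "(A1 *\<^sub>v y) $ ((i + 1) * m + a) = \<dots>" .
      have "(M *\<^sub>v x) $ ((i + 1) * m + a) + (A1 *\<^sub>v y) $ ((i + 1) * m + a) = 0"
        using arg_cong[OF top, of "\<lambda>w. w $ ((i + 1) * m + a)"] k M A1 by simp
      then show ?thesis unfolding * by (simp add: algebra_simps)
    qed
    have y_le: "degree (y $ (i * m + a)) \<le> D" if "i < \<eta>" "a < m" for i a
      using that
    \<comment> \<open>from the last block upwards, since \<open>y_step\<close> expresses block \<open>i\<close> by block \<open>i + 1\<close>\<close>
    proof (induction "\<eta> - i" arbitrary: i)
      case (Suc d)
      let ?k = "(i + 1) * m + a"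
      have k: "?k < p" unfolding p_def using Suc.prems by (intro kronecker_index_less) auto
      have "degree ((M *\<^sub>v x) $ ?k) \<le> l + D"
        using k M x grade
        by (intro degree_mult_mat_vec_le[OF M x k] x_le has_grade_degree_le) auto
      moreover have "degree (if i + 1 < \<eta> then y $ ?k else 0) \<le> l + D"
      proof -
        have "d = \<eta> - (i + 1)" using Suc.hyps(2) by simp
        then have "degree (y $ ?k) \<le> D" if "i + 1 < \<eta>"
          using Suc.hyps(1)[of "i + 1"] that Suc.prems by blast
        then show ?thesis by (auto intro: trans_le_add2)
      qed
      ultimately have "degree (monom 1 l * y $ (i * m + a)) \<le> l + D"
        unfolding y_step[OF Suc.prems] by (rule degree_diff_le[rotated])
      then show ?case
        by (cases "y $ (i * m + a) = 0") (auto simp: degree_mult_eq degree_monom_eq)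
    qed simp
    have y_le': "degree (y $ k) \<le> D" if k: "k < \<eta> * m" for k
    proof -
      have "k div m < \<eta>" using k by (rule less_mult_imp_div_less)
      moreover have "k mod m < m" using k by (intro mod_less_divisor) (auto intro: Nat.gr0I)
      ultimately show ?thesis using y_le[of "k div m" "k mod m"] by simp
    qed
    have "vec_degree (lift *\<^sub>v v) \<le> D"
      unfolding Zv vec_degree_le_iff using x y x_le y_le' by auto
    moreover have "D \<le> vec_degree (lift *\<^sub>v v)"
    proof -
      obtain a where a: "a < n" "v $ a \<noteq> 0" "degree (v $ a) = vec_degree v"
        using vec_degree_attained[OF v] .
      \<comment> \<open>the topmost block of \<open>x\<close> is \<open>\<mu>\<^sup>\<epsilon> v\<close>, and it attains the bound\<close>
      have aq: "a < q" using a unfolding q_def by simp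
      have "degree ((lift *\<^sub>v v) $ a) = degree (x $ a)" unfolding Zv using x y aq by simp
      also have "x $ a = monom 1 (l * \<epsilon>) * v $ a" using x_index[of 0 a] a by simp
      also have "degree \<dots> = D" unfolding D_def
        using a by (simp add: degree_mult_eq degree_monom_eq)
      finally have "degree ((lift *\<^sub>v v) $ a) = D" .
      moreover have "a < dim_vec (lift *\<^sub>v v)" unfolding Zv using x aq by simp
      ultimately show ?thesis using vec_degree_le_iff[of "lift *\<^sub>v v" "vec_degree (lift *\<^sub>v v)"] by auto
    qed
    ultimately show ?thesis unfolding D_def by simp
  qed
  show ?thesis unfolding pencil
    by (rule minimal_indices_shift[OF Pc carriers(1,2,3,4,5,6) _ uninject_inject proj_lift lift_proj
          degree_lift ind]) (simp add: pencil_lift P')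
qed

section \<open>Left minimal indices by transposition\<close>

lemma left_minimal_indices_transpose:
  "left_minimal_indices P = right_minimal_indices (transpose_mat P)"
proof -
  have "left_nullspace P = right_nullspace (transpose_mat P)"
  proof -
    have "mat_of_row y * X = 0\<^sub>m 1 (dim_col X) \<longleftrightarrow> transpose_mat X *\<^sub>v y = 0\<^sub>v (dim_col X)"
      if y: "y \<in> carrier_vec (dim_row X)" for X :: "'a poly fract mat" and y
    proof -
      have "(mat_of_row y * X) $$ (0, j) = (transpose_mat X *\<^sub>v y) $ j" if "j < dim_col X" for j
        using that y comm_scalar_prod[OF y, of "col X j"] by simp
      then show ?thesis
        by (auto simp: mat_eq_iff vec_eq_iff)
    qed
    from this[of _ "map_mat to_fract P"] show ?thesis
      by (auto simp: left_nullspace_def right_nullspace_def mat_kernel_def map_mat_transpose)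
  qed
  then show ?thesis
    by (intro ext) (simp add: left_minimal_indices_def right_minimal_indices_def)
qed

lemma has_grade_transpose:
  assumes "has_grade g P"
  shows "has_grade g (transpose_mat P)"
proof -
  obtain C :: "nat \<Rightarrow> 'a mat" where
    C: "\<forall>i\<le>g. C i \<in> carrier_mat (dim_row P) (dim_col P)"
       "P = mat (dim_row P) (dim_col P) (\<lambda>rc. \<Sum>i\<le>g. monom (C i $$ rc) i)"
    using assms unfolding has_grade_def by blast
  have "P $$ (i, j) = (\<Sum>k\<le>g. monom (C k $$ (i, j)) k)" if "i < dim_row P" "j < dim_col P" for i j
    by (subst C(2)) (use that in simp)
  moreover have "transpose_mat (C k) $$ (j, i) = C k $$ (i, j)"
    if "k \<le> g" "i < dim_row P" "j < dim_col P" for i j k using C(1) that by auto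
  ultimately show ?thesis unfolding has_grade_def
    using C(1) by (intro exI[of _ "\<lambda>i. transpose_mat (C i)"]) (auto intro!: eq_matI)
qed

lemma transpose_block_kronecker:
  fixes M :: "'a::field poly mat"
  assumes M: "M \<in> carrier_mat ((\<eta> + 1) * m) ((\<epsilon> + 1) * n)"
  shows "transpose_mat (block_kronecker \<epsilon> n \<eta> m l M) = block_kronecker \<eta> m \<epsilon> n l (transpose_mat M)"
proof -
  have L: "eval_at_power l (L_pencil k) \<in> carrier_mat k (k + 1)" for k
    using inner_carriers(1)[of l k] by (simp add: L_power_def)
  have A1: "transpose_mat (eval_at_power l (L_pencil \<eta>)) \<otimes>\<^sub>K 1\<^sub>m m \<in> carrier_mat ((\<eta> + 1) * m) (\<eta> * m)"
    and A2: "eval_at_power l (L_pencil \<epsilon>) \<otimes>\<^sub>K 1\<^sub>m n \<in> carrier_mat (\<epsilon> * n) ((\<epsilon> + 1) * n)"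
    using L by (auto intro!: kronecker_carrier simp del: mult_Suc)
  show ?thesis
    unfolding block_kronecker_def transpose_four_block_mat[OF M A1 A2 zero_carrier_mat]
    by (simp add: transpose_kronecker)
qed

section \<open>Shift of the minimal indices\<close>

theorem theorem6p3:
  fixes P M \<L> :: "'a::field poly mat"
    and n d k l \<epsilon> \<eta> :: nat
    and es hs :: "nat list"
  assumes "P \<in> carrier_mat n n"
    and "has_grade d P"
    and "singular_mat_poly P"
    and "d = k * l"
    and "is_block_kronecker \<epsilon> n \<eta> n l M \<L>"
    and "k = \<epsilon> + \<eta> + 1"
    and "P = (transpose_mat (eval_at_power l (Lambda_col \<eta>)) \<otimes>\<^sub>K 1\<^sub>m n) * M
               * (eval_at_power l (Lambda_col \<epsilon>) \<otimes>\<^sub>K 1\<^sub>m n)"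
  shows "(right_minimal_indices P es \<longrightarrow>
            right_minimal_indices \<L> (map (\<lambda>e. e + \<epsilon> * l) es)) \<and>
         (left_minimal_indices P hs \<longrightarrow>
            left_minimal_indices \<L> (map (\<lambda>h. h + \<eta> * l) hs))"
proof -
  have M: "M \<in> carrier_mat ((\<eta> + 1) * n) ((\<epsilon> + 1) * n)" and grade: "has_grade l M"
    and L: "\<L> = block_kronecker \<epsilon> n \<eta> n l M"
    using assms(5) unfolding is_block_kronecker_def by auto
  have Lambda: "eval_at_power l (Lambda_col k) \<otimes>\<^sub>K 1\<^sub>m n \<in> carrier_mat ((k + 1) * n) (1 * n)"
    for k and n :: nat
    by (intro kronecker_carrier one_carrier_mat inner_carriers(2)[unfolded Lambda_power_def])
  have MT: "transpose_mat M \<in> carrier_mat ((\<epsilon> + 1) * n) ((\<eta> + 1) * n)" using M by simp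
  have X: "transpose_mat (eval_at_power l (Lambda_col k)) \<otimes>\<^sub>K 1\<^sub>m n \<in> carrier_mat (1 * n) ((k + 1) * n)"
    for k and n :: nat
    using transpose_carrier_mat Lambda[of k n] by (metis transpose_kronecker transpose_one)
  have "transpose_mat P = (transpose_mat (eval_at_power l (Lambda_col \<epsilon>)) \<otimes>\<^sub>K 1\<^sub>m n) *
      (transpose_mat M * (eval_at_power l (Lambda_col \<eta>) \<otimes>\<^sub>K 1\<^sub>m n))"
    unfolding assms(7)
    by (simp only: transpose_mult[OF mult_carrier_mat[OF X M] Lambda] transpose_mult[OF X M]
        transpose_kronecker transpose_transpose transpose_one)
  also have "\<dots> = (transpose_mat (eval_at_power l (Lambda_col \<epsilon>)) \<otimes>\<^sub>K 1\<^sub>m n) *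
      transpose_mat M * (eval_at_power l (Lambda_col \<eta>) \<otimes>\<^sub>K 1\<^sub>m n)"
    by (rule assoc_mult_mat[OF X MT Lambda, symmetric])
  finally have PT: "transpose_mat P = \<dots>" .
  show ?thesis
    unfolding left_minimal_indices_transpose L transpose_block_kronecker[OF M]
    using block_kronecker_right_minimal_indices[OF M grade assms(7)]
      block_kronecker_right_minimal_indices[OF MT has_grade_transpose[OF grade] PT]
    by blast
qed

end
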